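(* Let $k\in\mathbb N_+$, let $\mathbb V^k$ be either $\mathbb P^k$ or $\mathbb Q^k$ (and $\mathbb V^{\lfloor k/2\rfloor}$ the space of the same family), let $\theta\in[-1,1]$, and define $\phi^\star(\theta,(\mathbb V^{\lfloor k/2\rfloor})^2):=\inf_{q\in\mathbb V^{\lfloor k/2\rfloor}}\phi(q^2;\theta)$. Suppose there is a feasible symmetric CAD for $(\theta,\mathbb V^k)$, $$\langle p\rangle_\Omega=\overline\omega\big[(1+\theta)\langle p\rangle_\Omega^x+(1-\theta)\langle p\rangle_\Omega^y\big]+\sum_{s=1}^S\omega_s\,\overline{p(x^{(s)},y^{(s)})}\qquad\forall p\in\mathbb V^k ,$$ whose boundary weight is $\overline\omega=\phi^\star(\theta,(\mathbb V^{\lfloor k/2\rfloor})^2)$. Then: (a) $\overline\omega_\star(\theta,\mathbb V^k)=\phi^\star(\theta,\mathbb V^k_+)=\phi^\star(\theta,(\mathbb V^{\lfloor k/2\rfloor})^2)$; (b) this CAD is a symmetric OCAD for $\mathbb V^k$ (and this $\theta$).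
   Context: $\mathbb P^k$: real polynomials in $(x,y)$ of total degree at most $k$; $\mathbb Q^k$: real polynomials of degree at most $k$ in each variable. $\Omega=[-1,1]^2$, $\langle p\rangle_\Omega=\frac14\iint_\Omega p$, $\langle p\rangle_\Omega^x=\frac14\int_{-1}^1[p(-1,y)+p(1,y)]dy$, $\langle p\rangle_\Omega^y=\frac14\int_{-1}^1[p(x,-1)+p(x,1)]dx$, $\overline{p(a,b)}=\frac14[p(a,b)+p(-a,b)+p(a,-b)+p(-a,-b)]$. A feasible symmetric CAD for $(\theta,\mathbb V^k)$ with boundary weight $\overline\omega$ is an identity of the displayed form, valid for all $p\in\mathbb V^k$, with $S\ge 0$ finite, $\overline\omega>0$, all $\omega_s>0$ and all $(x^{(s)},y^{(s)})\in[0,1]^2$. $\overline\omega_\star(\theta,\mathbb V^k)$ is the maximum of $\overline\omega$ over all such CADs (for the fixed $\theta$), and a symmetric OCAD is one attaining it. $\mathbb V^k_+=\{p\in\mathbb V^k:p\ge0\text{ on }\Omega\}$. For $p\in\mathbb V^k_+$, $\phi(p;\theta)=\dfrac{\langle p\rangle_\Omega}{(1+\theta)\langle p\rangle_\Omega^x+(1-\theta)\langle p\rangle_\Omega^y}$ if the denominator is nonzero, and $\phi(p;\theta)=+\infty$ otherwise; $\phi^\star(\theta,\mathbb V^k_+)=\inf_{p\in\mathbb V^k_+}\phi(p;\theta)$. *)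

theory Defs
  imports "HOL-Analysis.Analysis" "HOL-Computational_Algebra.Polynomial"
begin

text \<open>
  A real polynomial in \<open>(x, y)\<close> is an element of \<open>\<real>[x][y]\<close>, so that
  \<open>coeff (coeff p j) i\<close> is the coefficient of \<open>x^i y^j\<close>.
\<close>

type_synonym poly_xy = "real poly poly"

definition eval_xy :: "poly_xy \<Rightarrow> real \<Rightarrow> real \<Rightarrow> real" where
  "eval_xy p x y = poly (poly p [:y:]) x"

definition P_space :: "nat \<Rightarrow> poly_xy set" where
  "P_space k = {p. \<forall>i j. coeff (coeff p j) i \<noteq> 0 \<longrightarrow> i + j \<le> k}"

definition Q_space :: "nat \<Rightarrow> poly_xy set" where
  "Q_space k = {p. \<forall>i j. coeff (coeff p j) i \<noteq> 0 \<longrightarrow> i \<le> k \<and> j \<le> k}"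

definition avg_Omega :: "poly_xy \<Rightarrow> real" where
  "avg_Omega p = (1/4) * integral ({-1..1} \<times> {-1..1}) (\<lambda>(x, y). eval_xy p x y)"

definition avg_x :: "poly_xy \<Rightarrow> real" where
  "avg_x p = (1/4) * integral {-1..1} (\<lambda>y. eval_xy p (-1) y + eval_xy p 1 y)"

definition avg_y :: "poly_xy \<Rightarrow> real" where
  "avg_y p = (1/4) * integral {-1..1} (\<lambda>x. eval_xy p x (-1) + eval_xy p x 1)"

definition avg_sym :: "poly_xy \<Rightarrow> real \<Rightarrow> real \<Rightarrow> real" where
  "avg_sym p a b =
     (1/4) * (eval_xy p a b + eval_xy p (-a) b + eval_xy p a (-b) + eval_xy p (-a) (-b))"

definition bdry :: "real \<Rightarrow> poly_xy \<Rightarrow> real" where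
  "bdry \<theta> p = (1 + \<theta>) * avg_x p + (1 - \<theta>) * avg_y p"

text \<open>
  In the following, \<open>V\<close> is a space of polynomials, \<open>w\<close> the boundary weight, and
  \<open>\<omega> s\<close>, \<open>(X s, Y s)\<close> for \<open>1 \<le> s \<le> S\<close> are the internal weights and nodes;
  the values of \<open>\<omega>\<close>, \<open>X\<close>, \<open>Y\<close> outside this range are irrelevant.
\<close>

definition feasible_symmetric_CAD ::
  "real \<Rightarrow> poly_xy set \<Rightarrow> real \<Rightarrow> nat \<Rightarrow> (nat \<Rightarrow> real) \<Rightarrow> (nat \<Rightarrow> real) \<Rightarrow> (nat \<Rightarrow> real) \<Rightarrow> bool"
where
  "feasible_symmetric_CAD \<theta> V w S \<omega> X Y \<longleftrightarrow>
     w > 0 \<and>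
     (\<forall>s\<in>{1..S}. \<omega> s > 0 \<and> X s \<in> {0..1} \<and> Y s \<in> {0..1}) \<and>
     (\<forall>p\<in>V. avg_Omega p = w * bdry \<theta> p + (\<Sum>s=1..S. \<omega> s * avg_sym p (X s) (Y s)))"

definition boundary_weights :: "real \<Rightarrow> poly_xy set \<Rightarrow> real set" where
  "boundary_weights \<theta> V = {w. \<exists>S \<omega> X Y. feasible_symmetric_CAD \<theta> V w S \<omega> X Y}"

text \<open>
  The maximal boundary weight; it is meaningful only if the maximum is attained, i.e. if a
  symmetric OCAD (defined next, without reference to this operator) exists.
\<close>

definition omega_star :: "real \<Rightarrow> poly_xy set \<Rightarrow> real" where
  "omega_star \<theta> V = (GREATEST w. w \<in> boundary_weights \<theta> V)"

definition symmetric_OCAD ::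
  "real \<Rightarrow> poly_xy set \<Rightarrow> real \<Rightarrow> nat \<Rightarrow> (nat \<Rightarrow> real) \<Rightarrow> (nat \<Rightarrow> real) \<Rightarrow> (nat \<Rightarrow> real) \<Rightarrow> bool"
where
  "symmetric_OCAD \<theta> V w S \<omega> X Y \<longleftrightarrow>
     feasible_symmetric_CAD \<theta> V w S \<omega> X Y \<and> (\<forall>w'\<in>boundary_weights \<theta> V. w' \<le> w)"

definition nonneg_cone :: "poly_xy set \<Rightarrow> poly_xy set" where
  "nonneg_cone V = {p\<in>V. \<forall>x\<in>{-1..1}. \<forall>y\<in>{-1..1}. eval_xy p x y \<ge> 0}"

definition squares :: "poly_xy set \<Rightarrow> poly_xy set" where
  "squares W = {q\<^sup>2 | q. q \<in> W}"

definition phi :: "real \<Rightarrow> poly_xy \<Rightarrow> ereal" where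
  "phi \<theta> p = (if bdry \<theta> p \<noteq> 0 then ereal (avg_Omega p / bdry \<theta> p) else \<infinity>)"

definition phi_star :: "real \<Rightarrow> poly_xy set \<Rightarrow> ereal" where
  "phi_star \<theta> A = (INF p\<in>A. phi \<theta> p)"

end

theory Submission
  imports Defs
begin

text \<open>
  On a nonnegative polynomial the interior nodes of a feasible CAD contribute nonnegatively, so its
  boundary weight is a lower bound for \<open>phi\<close> on the nonnegative cone. Since squares of polynomials
  of half the degree lie in this cone, a weight equal to the infimum over those squares is squeezed
  between the two infima and dominates every other boundary weight.
\<close>

text \<open>A coefficient of a product is a double convolution sum, so if it is nonzero, some
  summand is, and with it both factors. As the exponents of the two factors add up to those of the
  product, this one fact bounds total degree and degree in each variable alike.\<close>

lemma coeff_coeff_mult_nonzeroE: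
  fixes p q :: "'a::comm_semiring_0 poly poly"
  assumes "coeff (coeff (p * q) j) i \<noteq> 0"
  obtains i' j' where "i' \<le> i" "j' \<le> j"
    "coeff (coeff p j') i' \<noteq> 0" "coeff (coeff q (j - j')) (i - i') \<noteq> 0"
proof -
  have "(\<Sum>j'\<le>j. \<Sum>i'\<le>i. coeff (coeff p j') i' * coeff (coeff q (j - j')) (i - i')) \<noteq> 0"
    using assms by (simp add: coeff_mult coeff_sum)
  then obtain j' where "j' \<le> j"
    "(\<Sum>i'\<le>i. coeff (coeff p j') i' * coeff (coeff q (j - j')) (i - i')) \<noteq> 0"
    by (metis (no_types, lifting) atMost_iff sum.neutral)
  moreover from this obtain i' where "i' \<le> i"
    "coeff (coeff p j') i' * coeff (coeff q (j - j')) (i - i') \<noteq> 0"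
    by (metis (no_types, lifting) atMost_iff sum.neutral)
  ultimately show thesis
    using that by (metis mult_zero_left mult_zero_right)
qed

lemma P_space_mult:
  assumes "p \<in> P_space m" "q \<in> P_space n" "m + n \<le> k"
  shows "p * q \<in> P_space k"
  using assms unfolding P_space_def
  by (fastforce elim!: coeff_coeff_mult_nonzeroE)

lemma Q_space_mult:
  assumes "p \<in> Q_space m" "q \<in> Q_space n" "m + n \<le> k"
  shows "p * q \<in> Q_space k"
  using assms unfolding Q_space_def
  by (fastforce elim!: coeff_coeff_mult_nonzeroE)

lemma squares_subset_nonneg_cone:
  assumes "V = P_space \<or> V = Q_space"
  shows "squares (V (k div 2)) \<subseteq> nonneg_cone (V k)"
proof -
  \<comment> \<open>Rounding down gives \<open>k div 2 + k div 2 \<le> k\<close> for odd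
    \<open>k\<close> as well.\<close>
  have "q\<^sup>2 \<in> V k" if "q \<in> V (k div 2)" for q
    using assms that P_space_mult[of q "k div 2" q "k div 2" k]
      Q_space_mult[of q "k div 2" q "k div 2" k]
    by (auto simp: power2_eq_square)
  then show ?thesis
    by (auto simp: squares_def nonneg_cone_def eval_xy_def)
qed

lemma bdry_nonneg:
  assumes "\<theta> \<in> {-1..1}" "p \<in> nonneg_cone V"
  shows "bdry \<theta> p \<ge> 0"
proof -
  \<comment> \<open>A non-integrable function has integral 0 by convention, so the bound holds in
    both cases.\<close>
  have int_nonneg: "integral {-1..1} f \<ge> 0"
    if "\<And>t. t \<in> {-1..1} \<Longrightarrow> f t \<ge> 0" for f :: "real \<Rightarrow> real"
    using that by (cases "f integrable_on {-1..1}")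
      (auto intro: integral_nonneg simp: not_integrable_integral)
  have "avg_x p \<ge> 0" "avg_y p \<ge> 0"
    using assms(2) unfolding avg_x_def avg_y_def nonneg_cone_def
    by (auto intro!: int_nonneg add_nonneg_nonneg)
  with assms(1) show ?thesis
    by (simp add: bdry_def)
qed

text \<open>All four reflections of a node in the unit square stay in the domain on which
  \<open>p\<close> is nonnegative.\<close>

lemma avg_sym_nonneg:
  assumes "p \<in> nonneg_cone V" "a \<in> {0..1}" "b \<in> {0..1}"
  shows "avg_sym p a b \<ge> 0"
  using assms by (auto simp: avg_sym_def nonneg_cone_def)

lemma boundary_weight_le_phi_star:
  assumes "\<theta> \<in> {-1..1}" "w \<in> boundary_weights \<theta> V"
  shows "ereal w \<le> phi_star \<theta> (nonneg_cone V)"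
  unfolding phi_star_def
proof (rule INF_greatest)
  fix p assume p: "p \<in> nonneg_cone V"
  obtain S \<omega> X Y where cad: "feasible_symmetric_CAD \<theta> V w S \<omega> X Y"
    using assms(2) by (auto simp: boundary_weights_def)
  have "(\<Sum>s=1..S. \<omega> s * avg_sym p (X s) (Y s)) \<ge> 0"
    using cad avg_sym_nonneg[OF p] unfolding feasible_symmetric_CAD_def
    by (intro sum_nonneg mult_nonneg_nonneg) (auto intro: less_imp_le)
  then have "w * bdry \<theta> p \<le> avg_Omega p"
    using cad p by (auto simp: feasible_symmetric_CAD_def nonneg_cone_def)
  \<comment> \<open>If \<open>bdry \<theta> p\<close> vanishes, \<open>phi\<close> is infinite;
    otherwise it is positive and can be divided by.\<close>
  then show "ereal w \<le> phi \<theta> p"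
    using bdry_nonneg[OF assms(1) p] by (auto simp: phi_def pos_le_divide_eq)
qed

theorem theorem3p27:
  fixes k :: nat and \<theta> :: real and V :: "nat \<Rightarrow> poly_xy set"
    and w :: real and S :: nat and \<omega> X Y :: "nat \<Rightarrow> real"
  assumes "k > 0"
    and "V = P_space \<or> V = Q_space"
    and "\<theta> \<in> {-1..1}"
    and "feasible_symmetric_CAD \<theta> (V k) w S \<omega> X Y"
    and "ereal w = phi_star \<theta> (squares (V (k div 2)))"
  shows "ereal (omega_star \<theta> (V k)) = phi_star \<theta> (nonneg_cone (V k))
       \<and> phi_star \<theta> (nonneg_cone (V k)) = phi_star \<theta> (squares (V (k div 2)))
       \<and> symmetric_OCAD \<theta> (V k) w S \<omega> X Y"
proof -
  have w: "w \<in> boundary_weights \<theta> (V k)"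
    using assms(4) by (auto simp: boundary_weights_def)
  \<comment> \<open>Enlarging the set from squares to the whole cone can only lower the
    infimum.\<close>
  have "phi_star \<theta> (nonneg_cone (V k)) \<le> ereal w"
    using squares_subset_nonneg_cone[OF assms(2)] unfolding assms(5) phi_star_def
    by (intro INF_superset_mono) auto
  then have phi_eq: "phi_star \<theta> (nonneg_cone (V k)) = ereal w"
    using boundary_weight_le_phi_star[OF assms(3) w] by (rule antisym)
  have max: "w' \<le> w" if "w' \<in> boundary_weights \<theta> (V k)" for w'
    using boundary_weight_le_phi_star[OF assms(3) that] phi_eq by simp
  \<comment> \<open>\<open>GREATEST\<close> is determined here because \<open>w\<close> is itself a
    boundary weight and bounds all others.\<close>
  have "omega_star \<theta> (V k) = w"
    unfolding omega_star_def using w max by (rule Greatest_equality)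
  with phi_eq max assms(4,5) show ?thesis
    by (auto simp: symmetric_OCAD_def)
qed

end
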